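(* Let $G=\mathrm{Sz}(q)$ be the Suzuki group over the field with $q=2^{2t+1}$ elements, where $t\ge 1$ is an integer. Then the Engel graph $\Gamma(G)$ is not strongly connected.
   Context: Commutators: $[a,b]=a^{-1}b^{-1}ab$, $[x,{}_0y]=x$, and $[x,{}_{i+1}y]=[[x,{}_iy],y]$ for $i\ge 0$. For a finite group $G$ with hypercenter $Z_\infty(G)$, the Engel graph $\Gamma(G)$ is the directed graph with vertex set $G\setminus Z_\infty(G)$ and an edge $x\mapsto y$ if and only if $[x,{}_ny]=1$ for some integer $n>0$. A directed graph is strongly connected if for every pair of vertices $(x,y)$ it contains a directed path from $x$ to $y$. *)

theory Defs
  imports
    "HOL-Analysis.Cartesian_Space"
    "HOL-Algebra.Generated_Groups"
    "Graph_Theory.Pair_Digraph"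
begin

(* HOL-Algebra's derived subgroups are built from x y x^-1 y^-1; the convention here is
   [a,b] = a^-1 b^-1 a b. *)
definition commutator :: "('g, 'm) monoid_scheme \<Rightarrow> 'g \<Rightarrow> 'g \<Rightarrow> 'g" where
  "commutator G a b = inv\<^bsub>G\<^esub> a \<otimes>\<^bsub>G\<^esub> inv\<^bsub>G\<^esub> b \<otimes>\<^bsub>G\<^esub> a \<otimes>\<^bsub>G\<^esub> b"

primrec iter_commutator :: "('g, 'm) monoid_scheme \<Rightarrow> 'g \<Rightarrow> nat \<Rightarrow> 'g \<Rightarrow> 'g" where
  "iter_commutator G x 0 y = x"
| "iter_commutator G x (Suc i) y = commutator G (iter_commutator G x i y) y"

(* An element x is central modulo Z_i iff [x,g] lies in Z_i for all g. *)
primrec upper_central :: "('g, 'm) monoid_scheme \<Rightarrow> nat \<Rightarrow> 'g set" where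
  "upper_central G 0 = {\<one>\<^bsub>G\<^esub>}"
| "upper_central G (Suc i) =
     {x \<in> carrier G. \<forall>g \<in> carrier G. commutator G x g \<in> upper_central G i}"

(* For a finite group the upper central series stabilises after finitely many steps,
   so the union over the natural numbers is its last term. *)
definition hypercenter :: "('g, 'm) monoid_scheme \<Rightarrow> 'g set" where
  "hypercenter G = (\<Union>i. upper_central G i)"

definition engel_graph :: "('g, 'm) monoid_scheme \<Rightarrow> 'g pair_pre_digraph" where
  "engel_graph G =
     \<lparr> pverts = carrier G - hypercenter G,
       parcs = {(x, y). x \<in> carrier G - hypercenter G \<and> y \<in> carrier G - hypercenter G \<and>
                        (\<exists>n>0. iter_commutator G x n y = \<one>\<^bsub>G\<^esub>)} \<rparr>"

(* Unlike the constant strongly_connected of Graph_Theory, this does not require the vertex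
   set to be nonempty, so its negation always yields two vertices with no path between them. *)
definition strongly_conn :: "('v, 'e) pre_digraph \<Rightarrow> bool" where
  "strongly_conn D \<longleftrightarrow> (\<forall>x \<in> verts D. \<forall>y \<in> verts D. x \<rightarrow>\<^sup>*\<^bsub>D\<^esub> y)"

definition GL4 :: "('a::field ^ 4 ^ 4) monoid" where
  "GL4 = \<lparr> carrier = {A. invertible A}, monoid.mult = (**), one = mat 1 \<rparr>"

(* For q = 2^(2t+1), the field automorphism whose square is x \<mapsto> x^2. *)
definition sz_aut :: "nat \<Rightarrow> 'a::field \<Rightarrow> 'a" where
  "sz_aut t x = x ^ (2 ^ (t + 1))"

(* Suzuki's generators of Sz(q) in GL(4,q): the matrices S(a,b) form a Sylow 2-subgroup,
   the matrices M(c) a complement to it in its normaliser, and T is an involution that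
   swaps the two points of the Suzuki-Tits ovoid fixed by all M(c). *)
definition sz_S :: "nat \<Rightarrow> 'a::field \<Rightarrow> 'a \<Rightarrow> 'a ^ 4 ^ 4" where
  "sz_S t a b = vector
     [vector [1, 0, 0, 0],
      vector [a, 1, 0, 0],
      vector [b, sz_aut t a, 1, 0],
      vector [a ^ 2 * sz_aut t a + a * b + sz_aut t b, a * sz_aut t a + b, a, 1]]"

definition sz_M :: "nat \<Rightarrow> 'a::field \<Rightarrow> 'a ^ 4 ^ 4" where
  "sz_M t c = vector
     [vector [c ^ (1 + 2 ^ t), 0, 0, 0],
      vector [0, c ^ (2 ^ t), 0, 0],
      vector [0, 0, inverse (c ^ (2 ^ t)), 0],
      vector [0, 0, 0, inverse (c ^ (1 + 2 ^ t))]]"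

definition sz_T :: "'a::field ^ 4 ^ 4" where
  "sz_T = vector
     [vector [0, 0, 0, 1],
      vector [0, 0, 1, 0],
      vector [0, 1, 0, 0],
      vector [1, 0, 0, 0]]"

(* Sz(q), where 'a is the field with q = 2^(2t+1) elements. *)
definition Sz :: "nat \<Rightarrow> ('a::field ^ 4 ^ 4) monoid" where
  "Sz t = GL4 \<lparr> carrier := generate GL4
     ({sz_S t a b | a b. True} \<union> {sz_M t c | c. c \<noteq> 0} \<union> {sz_T}) \<rparr>"

lemma group_GL4: "group (GL4 :: ('a::field ^ 4 ^ 4) monoid)"
proof (rule groupI)
  fix A :: "'a ^ 4 ^ 4" assume "A \<in> carrier GL4"
  then obtain B where B: "A ** B = mat 1" "B ** A = mat 1"
    by (auto simp: GL4_def invertible_def)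
  then show "\<exists>B \<in> carrier GL4. B \<otimes>\<^bsub>GL4\<^esub> A = \<one>\<^bsub>GL4\<^esub>"
    by (auto simp: GL4_def invertible_def)
next
  fix A B :: "'a ^ 4 ^ 4" assume "A \<in> carrier GL4" "B \<in> carrier GL4"
  then show "A \<otimes>\<^bsub>GL4\<^esub> B \<in> carrier GL4"
    by (simp add: GL4_def invertible_mult)
next
  show "\<one>\<^bsub>GL4\<^esub> \<in> carrier (GL4 :: ('a ^ 4 ^ 4) monoid)"
    by (auto simp: GL4_def invertible_def intro: exI[of _ "mat 1"])
qed (simp_all add: GL4_def matrix_mul_assoc)

lemma vector_4:
  fixes w x y z :: "'a::zero"
  shows "(vector [w, x, y, z] :: 'a ^ 4) $ 1 = w"
    and "(vector [w, x, y, z] :: 'a ^ 4) $ 2 = x"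
    and "(vector [w, x, y, z] :: 'a ^ 4) $ 3 = y"
    and "(vector [w, x, y, z] :: 'a ^ 4) $ 4 = z"
  by (simp_all add: vector_def)

lemma matrix_mult_4:
  fixes A B :: "'a::field ^ 4 ^ 4"
  shows "(A ** B) $ i $ j =
     A $ i $ 1 * B $ 1 $ j + A $ i $ 2 * B $ 2 $ j + A $ i $ 3 * B $ 3 $ j + A $ i $ 4 * B $ 4 $ j"
  by (simp add: matrix_matrix_mult_def sum_4)

lemma invertible_sz_S: "invertible (sz_S t (a::'a::field) b)"
proof -
  define c where "c = sz_aut t a"
  define d where "d = a ^ 2 * c + a * b + sz_aut t b"
  define e where "e = a * c + b"
  define y where "y = a * c - e"
  define B :: "'a ^ 4 ^ 4" where "B = vector
     [vector [1, 0, 0, 0],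
      vector [- a, 1, 0, 0],
      vector [a * c - b, - c, 1, 0],
      vector [a * b - d - y * a, y, - a, 1]]"
  have "B ** sz_S t a b = mat 1"
    by (simp add: vec_eq_iff forall_4 matrix_mult_4 sz_S_def B_def vector_4 mat_def
        flip: c_def e_def d_def)
       (simp add: y_def algebra_simps)
  then show ?thesis
    by (auto simp: invertible_left_inverse)
qed

lemma invertible_sz_M:
  assumes "(c::'a::field) \<noteq> 0"
  shows "invertible (sz_M t c)"
proof -
  define B :: "'a ^ 4 ^ 4" where "B = vector
     [vector [inverse (c ^ (1 + 2 ^ t)), 0, 0, 0],
      vector [0, inverse (c ^ (2 ^ t)), 0, 0],
      vector [0, 0, c ^ (2 ^ t), 0],
      vector [0, 0, 0, c ^ (1 + 2 ^ t)]]"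
  have "B ** sz_M t c = mat 1"
    using assms by (simp add: vec_eq_iff forall_4 matrix_mult_4 sz_M_def B_def vector_4 mat_def
        field_simps)
  then show ?thesis
    by (auto simp: invertible_left_inverse)
qed

lemma invertible_sz_T: "invertible (sz_T :: 'a::field ^ 4 ^ 4)"
proof -
  have "sz_T ** (sz_T :: 'a ^ 4 ^ 4) = mat 1"
    by (simp add: vec_eq_iff forall_4 matrix_mult_4 sz_T_def vector_4 mat_def)
  then show ?thesis
    by (auto simp: invertible_left_inverse)
qed

lemma group_Sz: "group (Sz t :: ('a::field ^ 4 ^ 4) monoid)"
proof -
  interpret GL: group "GL4 :: ('a ^ 4 ^ 4) monoid" by (rule group_GL4)
  show ?thesis
    unfolding Sz_def
    by (rule GL.subgroup_imp_group, rule GL.generate_is_subgroup)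
       (auto simp: GL4_def invertible_sz_S invertible_sz_M invertible_sz_T)
qed

end

theory Submission
  imports Defs "HOL-Algebra.Group_Action"
begin

text \<open>\<open>Sz(q)\<close> acts doubly transitively on the Suzuki-Tits ovoid; a nontrivial element fixes at most
  two points, an involution never fixes two, and an element that swaps two points fixes a third one.
  If \<open>y \<noteq> 1\<close> has a fixed point and \<open>[x, \<^sub>n y] = 1\<close>, then every iterated commutator, and
  finally \<open>x\<close> itself, preserves the set of fixed points of \<open>y\<close>, so \<open>x\<close> has a fixed point too.
  Hence no path of the Engel graph leads from an element without fixed points, which exists by
  Jordan's theorem, to an element with a fixed point.\<close>

section \<open>Doubly transitive actions with few fixed points\<close>

text \<open>\<open>base_three\<close>, \<open>base_square\<close> and \<open>base_swap\<close>
  concern one pair of points; by \<open>to_base\<close>, conjugation carries them to every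
  pair.\<close>

locale double_action = group_action G E \<phi> for G (structure) and E and \<phi> +
  fixes p\<^sub>0 q\<^sub>0 u
  assumes finite_group: "finite (carrier G)"
    and finite_points: "finite E"
    and base_points: "p\<^sub>0 \<in> E" "q\<^sub>0 \<in> E" "p\<^sub>0 \<noteq> q\<^sub>0"
    and to_base: "\<And>p q. \<lbrakk>p \<in> E; q \<in> E; p \<noteq> q\<rbrakk> \<Longrightarrow> \<exists>h \<in> carrier G. \<phi> h p = p\<^sub>0 \<and> \<phi> h q = q\<^sub>0"
    and base_three: "\<And>g r. \<lbrakk>g \<in> carrier G; \<phi> g p\<^sub>0 = p\<^sub>0; \<phi> g q\<^sub>0 = q\<^sub>0; r \<in> E;
        r \<noteq> p\<^sub>0; r \<noteq> q\<^sub>0; \<phi> g r = r\<rbrakk> \<Longrightarrow> g = \<one>"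
    and base_square: "\<And>g. \<lbrakk>g \<in> carrier G; \<phi> g p\<^sub>0 = p\<^sub>0; \<phi> g q\<^sub>0 = q\<^sub>0; g \<otimes> g = \<one>\<rbrakk> \<Longrightarrow> g = \<one>"
    and base_swap: "\<And>g. \<lbrakk>g \<in> carrier G; \<phi> g p\<^sub>0 = q\<^sub>0; \<phi> g q\<^sub>0 = p\<^sub>0\<rbrakk> \<Longrightarrow> \<exists>r \<in> E. \<phi> g r = r"
    and unipotent: "u \<in> carrier G" "\<And>p. p \<in> E \<Longrightarrow> \<phi> u p = p \<longleftrightarrow> p = p\<^sub>0"
begin

sublocale group G
  using group_hom group_hom.axioms(1) by blast

lemma act_closed: "\<lbrakk>g \<in> carrier G; p \<in> E\<rbrakk> \<Longrightarrow> \<phi> g p \<in> E"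
  using element_image by blast

lemma act_eq_iff: "\<lbrakk>g \<in> carrier G; p \<in> E; q \<in> E\<rbrakk> \<Longrightarrow> \<phi> g p = \<phi> g q \<longleftrightarrow> p = q"
  using inj_prop by (meson inj_on_eq_iff)

lemma act_one: "p \<in> E \<Longrightarrow> \<phi> \<one> p = p"
  by (metis id_eq_one restrict_apply')

lemma act_inv: "\<lbrakk>g \<in> carrier G; p \<in> E\<rbrakk> \<Longrightarrow> \<phi> (inv g) (\<phi> g p) = p"
  by (metis act_one composition_rule inv_closed l_inv)

lemma inv_cancel: "\<lbrakk>x \<in> carrier G; y \<in> carrier G\<rbrakk> \<Longrightarrow> inv x \<otimes> (x \<otimes> y) = y"
  "\<lbrakk>x \<in> carrier G; y \<in> carrier G\<rbrakk> \<Longrightarrow> x \<otimes> (inv x \<otimes> y) = y"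
  by (simp_all flip: m_assoc)

lemma act_conj:
  assumes "g \<in> carrier G" "h \<in> carrier G" "p \<in> E"
  shows "\<phi> (h \<otimes> g \<otimes> inv h) (\<phi> h p) = \<phi> h (\<phi> g p)"
  using assms by (simp add: composition_rule act_closed act_inv)

lemma conj_eq_one_iff:
  assumes "g \<in> carrier G" "h \<in> carrier G"
  shows "h \<otimes> g \<otimes> inv h = \<one> \<longleftrightarrow> g = \<one>"
proof
  assume "h \<otimes> g \<otimes> inv h = \<one>"
  then have "h \<otimes> g = h"
    using assms by (metis inv_closed inv_equality inv_inv m_closed)
  then show "g = \<one>"
    using assms by simp
qed (use assms in simp)

lemma three_fixed:
  assumes "g \<in> carrier G" "p \<in> E" "q \<in> E" "r \<in> E" "p \<noteq> q" "r \<noteq> p" "r \<noteq> q"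
    and "\<phi> g p = p" "\<phi> g q = q" "\<phi> g r = r"
  shows "g = \<one>"
proof -
  obtain h where h: "h \<in> carrier G" "\<phi> h p = p\<^sub>0" "\<phi> h q = q\<^sub>0"
    using to_base assms by blast
  have "h \<otimes> g \<otimes> inv h = \<one>"
  proof (rule base_three)
    show "h \<otimes> g \<otimes> inv h \<in> carrier G"
      using assms h by simp
    show "\<phi> (h \<otimes> g \<otimes> inv h) p\<^sub>0 = p\<^sub>0" "\<phi> (h \<otimes> g \<otimes> inv h) q\<^sub>0 = q\<^sub>0"
      using act_conj[of g h p] act_conj[of g h q] assms h by simp_all
    show "\<phi> (h \<otimes> g \<otimes> inv h) (\<phi> h r) = \<phi> h r"
      using act_conj[of g h r] assms h by simp
    show "\<phi> h r \<in> E" "\<phi> h r \<noteq> p\<^sub>0" "\<phi> h r \<noteq> q\<^sub>0"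
      using act_closed[of h r] act_eq_iff[of h r p] act_eq_iff[of h r q] assms h by simp_all
  qed
  then show ?thesis
    using conj_eq_one_iff[OF assms(1) h(1)] by simp
qed

lemma two_fixed_square:
  assumes "g \<in> carrier G" "p \<in> E" "q \<in> E" "p \<noteq> q"
    and "\<phi> g p = p" "\<phi> g q = q" "g \<otimes> g = \<one>"
  shows "g = \<one>"
proof -
  obtain h where h: "h \<in> carrier G" "\<phi> h p = p\<^sub>0" "\<phi> h q = q\<^sub>0"
    using to_base assms by blast
  have "(h \<otimes> g \<otimes> inv h) \<otimes> (h \<otimes> g \<otimes> inv h) = h \<otimes> (g \<otimes> g) \<otimes> inv h"
    using assms(1) h(1) by (simp add: m_assoc inv_cancel)
  then have "h \<otimes> g \<otimes> inv h = \<one>"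
    using act_conj[of g h p] act_conj[of g h q] assms h
    by (simp add: base_square)
  then show ?thesis
    using conj_eq_one_iff[OF assms(1) h(1)] by simp
qed

lemma swap_fixed:
  assumes "g \<in> carrier G" "p \<in> E" "q \<in> E" "p \<noteq> q" "\<phi> g p = q" "\<phi> g q = p"
  shows "\<exists>r \<in> E. \<phi> g r = r"
proof -
  obtain h where h: "h \<in> carrier G" "\<phi> h p = p\<^sub>0" "\<phi> h q = q\<^sub>0"
    using to_base assms by blast
  have "\<exists>r \<in> E. \<phi> (h \<otimes> g \<otimes> inv h) r = r"
    using act_conj[of g h p] act_conj[of g h q] assms h by (intro base_swap) simp_all
  then obtain r where r: "r \<in> E" "\<phi> (h \<otimes> g \<otimes> inv h) r = r"
    by blast
  obtain s where s: "s \<in> E" "\<phi> h s = r"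
    using bij_prop1[OF h(1) r(1)] by blast
  then have "\<phi> h (\<phi> g s) = \<phi> h s"
    using act_conj[OF assms(1) h(1), of s] r by simp
  then show ?thesis
    using s act_eq_iff[OF h(1)] act_closed[OF assms(1)] by blast
qed

section \<open>Commutators and fixed points\<close>

lemma commutator_closed:
  "\<lbrakk>x \<in> carrier G; y \<in> carrier G\<rbrakk> \<Longrightarrow> commutator G x y \<in> carrier G"
  by (simp add: commutator_def)

lemma iter_commutator_closed:
  "\<lbrakk>x \<in> carrier G; y \<in> carrier G\<rbrakk> \<Longrightarrow> iter_commutator G x n y \<in> carrier G"
  by (induction n) (auto simp: commutator_closed)

text \<open>This is \<open>y x [x, y] = x y\<close>, applied to \<open>p\<close>. It transfers
  knowledge about \<open>[x, y]\<close> to \<open>x\<close>: if \<open>y\<close> and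
  \<open>[x, y]\<close> both fix \<open>p\<close>, then \<open>y\<close> fixes
  \<open>x p\<close>.\<close>

lemma act_commutator:
  assumes "x \<in> carrier G" "y \<in> carrier G" "p \<in> E"
  shows "\<phi> y (\<phi> x (\<phi> (commutator G x y) p)) = \<phi> x (\<phi> y p)"
proof -
  have "y \<otimes> (x \<otimes> commutator G x y) = x \<otimes> y"
    using assms by (simp add: commutator_def m_assoc inv_cancel)
  then show ?thesis
    using assms by (metis composition_rule commutator_closed act_closed m_closed)
qed

definition fixes_point where
  "fixes_point g \<longleftrightarrow> (\<exists>p \<in> E. \<phi> g p = p)"

text \<open>Descent: if \<open>[c, y]\<close> fixes \<open>p\<close>, then \<open>y\<close> fixes
  \<open>c p\<close>, and therefore \<open>c p = p\<close>.\<close>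

lemma only_fixed_point_engel:
  assumes x: "x \<in> carrier G" and y: "y \<in> carrier G" "p \<in> E" "\<And>r. r \<in> E \<Longrightarrow> \<phi> y r = r \<longleftrightarrow> r = p"
    and engel: "iter_commutator G x n y = \<one>"
  shows "\<phi> x p = p"
proof -
  \<comment> \<open>Counting down from \<open>n\<close> lets the induction start at the identity and
    end at \<open>x\<close>; once \<open>i \<ge> n\<close>, truncated subtraction makes the step
    trivial.\<close>
  have "\<phi> (iter_commutator G x (n - i) y) p = p" for i
  proof (induction i)
    case 0
    then show ?case using engel y by (simp add: act_one)
  next
    case (Suc i)
    let ?c = "iter_commutator G x (n - Suc i) y"
    show ?case
    proof (cases "i < n")
      case True
      then have "n - i = Suc (n - Suc i)" by simp
      then have "\<phi> (commutator G ?c y) p = p"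
        using Suc by simp
      then have "\<phi> y (\<phi> ?c p) = \<phi> ?c p"
        using act_commutator[of ?c y p] iter_commutator_closed[OF x y(1)] y(2) y(3)[OF y(2)] y(1) by simp
      then show ?thesis
        using y act_closed iter_commutator_closed x by metis
    qed (use Suc in simp)
  qed
  from this[of n] show ?thesis by simp
qed

text \<open>The set of fixed points of \<open>y\<close> has one or two elements. If it is invariant under \<open>[c, y]\<close>,
  then it is invariant under \<open>c\<close>; descending along the iterated commutators yields the claim.\<close>

lemma fixes_point_of_engel:
  assumes x: "x \<in> carrier G" and y: "y \<in> carrier G" "y \<noteq> \<one>" "fixes_point y"
    and engel: "iter_commutator G x n y = \<one>"
  shows "fixes_point x"
proof -
  obtain p where p: "p \<in> E" "\<phi> y p = p"
    using y by (auto simp: fixes_point_def)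
  show ?thesis
  proof (cases "\<exists>q \<in> E. q \<noteq> p \<and> \<phi> y q = q")
    case False
    then have "\<phi> x p = p"
      using only_fixed_point_engel[OF x y(1) p(1) _ engel] p by blast
    then show ?thesis
      using p by (auto simp: fixes_point_def)
  next
    case True
    then obtain q where q: "q \<in> E" "q \<noteq> p" "\<phi> y q = q"
      by blast
    have only: "r = p \<or> r = q" if "r \<in> E" "\<phi> y r = r" for r
      using three_fixed[of y p q r] y p q that by blast
    \<comment> \<open>A third fixed point of \<open>y \<otimes> y\<close> would make
      \<open>y\<close> an involution with two fixed points.\<close>
    have swap: "r = p \<or> r = q" if r: "r \<in> E" "\<phi> y (\<phi> y r) = r" for r
    proof (rule ccontr)
      assume "\<not> (r = p \<or> r = q)"
      then have "y \<otimes> y = \<one>"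
        using three_fixed[of "y \<otimes> y" p q r] y p q r by (simp add: composition_rule)
      then show False
        using two_fixed_square[of y p q] y p q by blast
    qed
    have "\<phi> (iter_commutator G x (n - i) y) ` {p, q} \<subseteq> {p, q}" for i
    proof (induction i)
      case 0
      then show ?case using engel p q by (simp add: act_one)
    next
      case (Suc i)
      let ?c = "iter_commutator G x (n - Suc i) y"
      show ?case
      proof (cases "i < n")
        case True
        then have "n - i = Suc (n - Suc i)" by simp
        then have c': "\<phi> (commutator G ?c y) ` {p, q} \<subseteq> {p, q}"
          using Suc by simp
        have c: "?c \<in> carrier G"
          using iter_commutator_closed x y by blast
        have E: "\<phi> ?c p \<in> E" "\<phi> ?c q \<in> E" "commutator G ?c y \<in> carrier G"
          using act_closed c p q y commutator_closed by auto
        have ne: "\<phi> (commutator G ?c y) p \<noteq> \<phi> (commutator G ?c y) q"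
          using act_eq_iff E p q by blast
        have eqs: "\<phi> y (\<phi> ?c (\<phi> (commutator G ?c y) p)) = \<phi> ?c p"
          "\<phi> y (\<phi> ?c (\<phi> (commutator G ?c y) q)) = \<phi> ?c q"
          using act_commutator[of ?c y] c y p q by auto
        from c' ne consider
          "\<phi> (commutator G ?c y) p = p" "\<phi> (commutator G ?c y) q = q"
          | "\<phi> (commutator G ?c y) p = q" "\<phi> (commutator G ?c y) q = p"
          by auto
        then show ?thesis
        proof cases
          case 1
          then show ?thesis using eqs only E by auto
        next
          case 2
          \<comment> \<open>If \<open>[c, y]\<close> interchanges \<open>p\<close> and
            \<open>q\<close>, then \<open>y\<close> interchanges \<open>c p\<close> and
            \<open>c q\<close>, so \<open>y \<otimes> y\<close> fixes both.\<close>
          then show ?thesis using eqs swap E by auto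
        qed
      qed (use Suc in simp)
    qed
    from this[of n] have "\<phi> x p = p \<or> \<phi> x p = q" "\<phi> x q = p \<or> \<phi> x q = q"
      by auto
    moreover have "\<phi> x p \<noteq> \<phi> x q"
      using act_eq_iff x p q by blast
    \<comment> \<open>If \<open>x\<close> fixes neither \<open>p\<close> nor \<open>q\<close>, it
      interchanges them.\<close>
    ultimately show ?thesis
      using swap_fixed[of x p q] x p q by (auto simp: fixes_point_def)
  qed
qed

section \<open>Transitivity and elements without fixed points\<close>

lemma transitive:
  assumes "p \<in> E" "q \<in> E"
  shows "\<exists>g \<in> carrier G. \<phi> g p = q"
proof -
  \<comment> \<open>\<open>to_base\<close> moves pairs, so \<open>r\<close> needs a companion:
    \<open>q\<^sub>0\<close>, or \<open>p\<^sub>0\<close> if \<open>r\<close> is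
    \<open>q\<^sub>0\<close> itself.\<close>
  have base: "\<exists>g \<in> carrier G. \<phi> g r = p\<^sub>0" if "r \<in> E" for r
  proof (cases "r = q\<^sub>0")
    case True
    obtain g where "g \<in> carrier G" "\<phi> g q\<^sub>0 = p\<^sub>0"
      using to_base[of q\<^sub>0 p\<^sub>0] base_points by auto
    then show ?thesis using True by blast
  next
    case False
    then show ?thesis using to_base[of r q\<^sub>0] base_points that by blast
  qed
  obtain g h where gh: "g \<in> carrier G" "\<phi> g p = p\<^sub>0" "h \<in> carrier G" "\<phi> h q = p\<^sub>0"
    using base assms by meson
  have "\<phi> (inv h \<otimes> g) p = q"
    using gh assms act_inv[of h q] by (simp add: composition_rule)
  then show ?thesis
    using gh by blast
qed

text \<open>Jordan's theorem: by Burnside's lemma the average number of fixed points is one, while the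
  identity has at least two.\<close>

lemma ex_fixed_point_free: "\<exists>x \<in> carrier G. \<not> fixes_point x"
proof (rule ccontr)
  assume *: "\<not> ?thesis"
  interpret transitive_action G E \<phi>
    by unfold_locales (use transitive in blast)
  have "card (orbits G E \<phi>) = 1"
    using base_points by (intro transitive_action.one_orbit) (auto intro: transitive_action_axioms)
  then have sum: "(\<Sum>g \<in> carrier G. card (invariants E \<phi> g)) = (\<Sum>g \<in> carrier G. 1)"
    using burnside finite_group finite_points by (simp add: order_def)
  have "card (invariants E \<phi> g) \<ge> 1" if "g \<in> carrier G" for g
  proof -
    have "invariants E \<phi> g \<noteq> {}"
      using * that by (auto simp: fixes_point_def invariants_def)
    moreover have "finite (invariants E \<phi> g)"
      using finite_points by (simp add: invariants_def)
    ultimately show ?thesis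
      by (simp add: Suc_le_eq card_gt_0_iff)
  qed
  moreover have "card (invariants E \<phi> \<one>) > 1"
  proof -
    have "{p\<^sub>0, q\<^sub>0} \<subseteq> invariants E \<phi> \<one>"
      using base_points by (auto simp: invariants_def act_one)
    moreover have "finite (invariants E \<phi> \<one>)"
      using finite_points by (simp add: invariants_def)
    ultimately have "card {p\<^sub>0, q\<^sub>0} \<le> card (invariants E \<phi> \<one>)"
      by (rule card_mono[rotated])
    then show ?thesis
      using base_points by simp
  qed
  ultimately have "(\<Sum>g \<in> carrier G. 1) < (\<Sum>g \<in> carrier G. card (invariants E \<phi> g))"
    using finite_group by (intro sum_strict_mono_ex1) auto
  then show False
    using sum by simp
qed

section \<open>The hypercentre and the Engel graph\<close>

text \<open>Each commutator with \<open>y\<close> descends one term of the upper central series, so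
  the \<open>n\<close>-th one lies in the trivial term.\<close>

lemma upper_central_engel:
  assumes "x \<in> upper_central G n" "x \<in> carrier G" "y \<in> carrier G"
  shows "iter_commutator G x n y = \<one>"
proof -
  have "iter_commutator G x i y \<in> upper_central G (n - i)" if "i \<le> n" for i
    using that
  proof (induction i)
    case (Suc i)
    then have "n - i = Suc (n - Suc i)" by simp
    then show ?case using Suc assms by auto
  qed (use assms in simp)
  from this[of n] show ?thesis by simp
qed

lemma u_not_one: "u \<noteq> \<one>"
  using unipotent base_points act_one by metis

text \<open>A hypercentral \<open>x\<close> satisfies an Engel condition with respect to
  \<open>u\<close>, which has a fixed point; then \<open>x\<close> would have one as well.\<close>

lemma fixed_point_free_not_hypercentral:
  assumes "x \<in> carrier G" "\<not> fixes_point x"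
  shows "x \<notin> hypercenter G"
proof
  assume "x \<in> hypercenter G"
  then obtain n where "x \<in> upper_central G n"
    by (auto simp: hypercenter_def)
  then have "iter_commutator G x n u = \<one>"
    using upper_central_engel assms unipotent by blast
  then have "fixes_point x"
    using fixes_point_of_engel assms u_not_one unipotent base_points by (auto simp: fixes_point_def)
  then show False
    using assms by blast
qed

text \<open>Some conjugate \<open>v\<close> of \<open>u\<close> fixes only \<open>q\<^sub>0\<close>.
  Were \<open>u\<close> hypercentral, its Engel condition with respect to \<open>v\<close> would
  force \<open>u\<close> to fix \<open>q\<^sub>0\<close>.\<close>

lemma unipotent_not_hypercentral: "u \<notin> hypercenter G"
proof
  assume "u \<in> hypercenter G"
  then obtain n where n: "u \<in> upper_central G n"
    by (auto simp: hypercenter_def)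
  obtain h where h: "h \<in> carrier G" "\<phi> h p\<^sub>0 = q\<^sub>0"
    using transitive base_points by blast
  define v where "v = h \<otimes> u \<otimes> inv h"
  have v: "v \<in> carrier G"
    using h unipotent by (simp add: v_def)
  have "\<phi> v r = r \<longleftrightarrow> r = q\<^sub>0" if "r \<in> E" for r
  proof -
    obtain s where s: "s \<in> E" "\<phi> h s = r"
      using bij_prop1[OF h(1) \<open>r \<in> E\<close>] by blast
    have "\<phi> v r = \<phi> h (\<phi> u s)"
      using act_conj[of u h s] s h unipotent by (simp add: v_def)
    then show ?thesis
      using s h unipotent base_points act_eq_iff act_closed by metis
  qed
  then have "\<phi> u q\<^sub>0 = q\<^sub>0"
    using only_fixed_point_engel[of u v q\<^sub>0 n] upper_central_engel[OF n] unipotent v base_points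
    by blast
  then show False
    using unipotent base_points by auto
qed

theorem engel_graph_not_strongly_conn: "\<not> strongly_conn (with_proj (engel_graph G))"
proof
  assume conn: "strongly_conn (with_proj (engel_graph G))"
  obtain x where x: "x \<in> carrier G" "\<not> fixes_point x"
    using ex_fixed_point_free by blast
  let ?D = "with_proj (engel_graph G)"
  have "x \<in> verts ?D" "u \<in> verts ?D"
    using x fixed_point_free_not_hypercentral unipotent_not_hypercentral unipotent
    by (auto simp: engel_graph_def)
  then have "x \<rightarrow>\<^sup>*\<^bsub>?D\<^esub> u"
    using conn by (auto simp: strongly_conn_def)
  then have "(x, u) \<in> (parcs (engel_graph G))\<^sup>*"
    using reachable_rtranclI by fastforce
  \<comment> \<open>Having no fixed point propagates forward along arcs: if the head of an arc fixed
    a point, so would its tail.\<close>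
  then have "\<not> fixes_point u"
  proof (induction rule: rtrancl_induct)
    case base
    then show ?case using x by blast
  next
    case (step y z)
    then obtain n where n: "iter_commutator G y n z = \<one>"
      and yz: "y \<in> carrier G" "z \<in> carrier G" "z \<notin> hypercenter G"
      by (auto simp: engel_graph_def)
    have "\<one> \<in> hypercenter G"
      unfolding hypercenter_def by (rule UN_I[of 0]) auto
    then have "z \<noteq> \<one>"
      using yz by blast
    then show ?case
      using fixes_point_of_engel[OF yz(1,2) _ _ n] step by blast
  qed
  then show False
    using unipotent base_points by (auto simp: fixes_point_def)
qed

end

section \<open>The field of order \<open>2 ^ (2 * t + 1)\<close> and the automorphism
  \<open>\<theta>\<close>\<close>

text \<open>Translation by \<open>1\<close> permutes the ring, so the sum of all
  \<open>x + 1\<close> equals the sum of all \<open>x\<close>.\<close>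

lemma of_nat_card_eq_0: "of_nat CARD('a::{ring_1,finite}) = (0::'a)"
proof -
  have "(\<Sum>x\<in>UNIV. x :: 'a) = (\<Sum>x\<in>UNIV. x + 1)"
    by (rule sum.reindex_bij_witness[of _ "\<lambda>x. x + 1" "\<lambda>x. x - 1"]) auto
  then show ?thesis
    by (simp add: sum.distrib)
qed

text \<open>Multiplication by a nonzero \<open>x\<close> permutes the nonzero elements; comparing
  products gives \<open>x ^ (CARD('a) - 1) = 1\<close>.\<close>

lemma power_card_eq_self: "(x::'a::{field,finite}) ^ CARD('a) = x"
proof (cases "x = 0")
  case False
  have "(\<Prod>y\<in>UNIV - {0}. y :: 'a) = (\<Prod>y\<in>UNIV - {0}. x * y)"
    using False by (intro prod.reindex_bij_witness[of _ "\<lambda>y. x * y" "\<lambda>y. y / x"]) auto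
  then have "x ^ (CARD('a) - 1) = 1"
    by (simp add: prod.distrib card_Diff_singleton)
  moreover have "CARD('a) = Suc (CARD('a) - 1)"
    by simp
  ultimately show ?thesis
    by (metis mult.right_neutral power_Suc)
qed (simp add: zero_power)

text \<open>The field enters as a type; the parameter \<open>field_type\<close> lets an
  interpretation choose it.\<close>

locale suzuki_field =
  fixes t :: nat and field_type :: "'a::{field,finite} itself"
  assumes card_field: "CARD('a) = 2 ^ (2 * t + 1)"
begin

lemma two_eq_0: "(2::'a) = 0"
proof -
  have "(2::'a) ^ (2 * t + 1) = 0"
    using of_nat_card_eq_0[where 'a = 'a] by (simp add: card_field)
  then show ?thesis
    by (simp only: power_eq_0_iff)
qed

lemma add_self: "(x::'a) + x = 0" "(x::'a) + (x + y) = y"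
  using two_eq_0 by (simp_all flip: mult_2 add.assoc)

lemma uminus_eq: "- x = (x::'a)" and diff_eq: "(x::'a) - y = x + y"
proof -
  show *: "- x = x" for x :: 'a
    using add_self(1)[of x] by (simp add: add_eq_0_iff)
  show "x - y = x + y"
    by (simp only: diff_conv_add_uminus *)
qed

lemmas char2 = add_self uminus_eq diff_eq

lemma eq_iff_add_eq_0: "(x::'a) = y \<longleftrightarrow> x + y = 0"
  by (auto simp: add_eq_0_iff uminus_eq)

lemma power2_add: "((x::'a) + y)\<^sup>2 = x\<^sup>2 + y\<^sup>2"
  by (simp add: power2_eq_square algebra_simps char2)

lemma power2_eq_iff2: "(x::'a)\<^sup>2 = y\<^sup>2 \<longleftrightarrow> x = y"
  by (metis eq_iff_add_eq_0 power2_add power_eq_0_iff zero_less_numeral)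

lemma power2_eq_1_iff2: "(x::'a)\<^sup>2 = 1 \<longleftrightarrow> x = 1"
  using power2_eq_iff2[of x 1] by simp

lemma power_2_power_add: "((x::'a) + y) ^ 2 ^ n = x ^ 2 ^ n + y ^ 2 ^ n"
  by (induction n) (simp_all add: power_mult power2_add mult.commute[of 2])

abbreviation \<theta> :: "'a \<Rightarrow> 'a" where
  "\<theta> \<equiv> sz_aut t"

lemma aut_add: "\<theta> (x + y) = \<theta> x + \<theta> y"
  unfolding sz_aut_def by (rule power_2_power_add)

lemma aut_mult: "\<theta> (x * y) = \<theta> x * \<theta> y"
  by (simp add: sz_aut_def power_mult_distrib)

lemma aut_power: "\<theta> (x ^ n) = \<theta> x ^ n"
  by (simp add: sz_aut_def mult.commute flip: power_mult)

lemma aut_divide: "\<theta> (x / y) = \<theta> x / \<theta> y"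
  by (simp add: sz_aut_def power_divide)

lemma aut_simps: "\<theta> 0 = 0" "\<theta> 1 = 1" "\<theta> x = 0 \<longleftrightarrow> x = 0"
  by (simp_all add: sz_aut_def)

lemma power_field: "(x::'a) ^ 2 ^ (2 * t + 1) = x"
  using power_card_eq_self[of x] by (simp only: card_field)

text \<open>Applying \<open>\<theta>\<close> twice raises to the power
  \<open>2 ^ (2 * t + 2)\<close>, twice the order of the field, and
  \<open>x ^ CARD('a) = x\<close>.\<close>

lemma aut_aut: "\<theta> (\<theta> x) = x\<^sup>2"
proof -
  have "(t + 1) + (t + 1) = (2 * t + 1) + 1"
    by simp
  then have "(2::nat) ^ (t + 1) * 2 ^ (t + 1) = 2 ^ (2 * t + 1) * 2"
    by (metis power_add power_one_right)
  then have "\<theta> (\<theta> x) = (x ^ 2 ^ (2 * t + 1))\<^sup>2"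
    by (simp only: sz_aut_def flip: power_mult)
  then show ?thesis
    by (simp only: power_field)
qed

text \<open>The exponents \<open>2 ^ t\<close> and \<open>2 ^ (t + 1)\<close> multiply to the order
  of the field, so \<open>c ^ 2 ^ t\<close>, from which \<open>sz_M\<close> is built, is the
  preimage of \<open>c\<close> under \<open>\<theta>\<close>.\<close>

lemma aut_half: "\<theta> (c ^ 2 ^ t) = c" and aut_eq_half: "\<theta> c = (c ^ 2 ^ t)\<^sup>2"
proof -
  have "t + (t + 1) = 2 * t + 1"
    by simp
  then have "(2::nat) ^ t * 2 ^ (t + 1) = 2 ^ (2 * t + 1)"
    by (metis power_add)
  then have "\<theta> (c ^ 2 ^ t) = c ^ 2 ^ (2 * t + 1)"
    by (simp only: sz_aut_def flip: power_mult)
  then show "\<theta> (c ^ 2 ^ t) = c"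
    by (simp only: power_field)
  show "\<theta> c = (c ^ 2 ^ t)\<^sup>2"
    by (simp add: sz_aut_def mult.commute flip: power_mult)
qed

lemma ex_sqrt: "\<exists>s::'a. s\<^sup>2 = c"
proof
  have "(c ^ 2 ^ (2 * t))\<^sup>2 = c ^ 2 ^ (2 * t + 1)"
    by (simp add: mult.commute flip: power_mult)
  then show "(c ^ 2 ^ (2 * t))\<^sup>2 = c"
    by (simp only: power_field)
qed

section \<open>The Suzuki-Tits ovoid and its tangent lines\<close>

definition ovoid :: "'a \<Rightarrow> 'a \<Rightarrow> 'a" where
  "ovoid a b = a\<^sup>2 * \<theta> a + a * b + \<theta> b"

text \<open>Substituting \<open>b = a * \<theta> a * u\<close> turns a zero with
  \<open>a \<noteq> 0\<close> into \<open>\<theta> u = u + 1\<close>. Applying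
  \<open>\<theta>\<close> again gives \<open>u\<^sup>2 = u\<close>, so \<open>u\<close> is
  \<open>0\<close> or \<open>1\<close>; but \<open>\<theta>\<close> fixes both.\<close>

lemma ovoid_eq_0_iff: "ovoid a b = 0 \<longleftrightarrow> a = 0 \<and> b = 0"
proof
  assume 0: "ovoid a b = 0"
  show "a = 0 \<and> b = 0"
  proof (cases "a = 0")
    case True
    then show ?thesis using 0 by (simp add: ovoid_def aut_simps)
  next
    case False
    define u where "u = b / (a * \<theta> a)"
    have b: "b = a * \<theta> a * u"
      using False by (simp add: u_def aut_simps)
    have "a\<^sup>2 * \<theta> a * (1 + u + \<theta> u) = 0"
      using 0 by (simp add: ovoid_def b aut_mult aut_aut power2_eq_square algebra_simps)
    then have "1 + u + \<theta> u = 0"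
      using False by (simp add: aut_simps)
    then have u: "\<theta> u = u + 1"
      by (metis add.commute eq_iff_add_eq_0)
    then have "\<theta> (\<theta> u) = u"
      by (simp add: aut_add aut_simps char2 add.assoc)
    then have "u\<^sup>2 = u"
      by (simp add: aut_aut)
    then have "u = 0 \<or> u = 1"
      by (simp add: power2_eq_square)
    then show ?thesis
      using u by (auto simp: aut_simps two_eq_0)
  qed
qed (simp add: ovoid_def aut_simps)

lemma aut_ovoid: "\<theta> (ovoid a b) = a\<^sup>2 * (\<theta> a)\<^sup>2 + \<theta> a * \<theta> b + b\<^sup>2"
  by (simp add: ovoid_def aut_add aut_mult aut_power aut_aut mult.commute)

text \<open>For nonzero \<open>F = ovoid a b\<close>, division by
  \<open>F\<^sup>2 * \<theta> F\<close> gives \<open>ovoid (b / F) (a / F) = 1 / F\<close>: this is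
  why \<open>sz_T\<close> preserves the ovoid.\<close>

lemma ovoid_aut_relation:
  "b\<^sup>2 * \<theta> b + a * b * \<theta> (ovoid a b) + \<theta> a * (ovoid a b)\<^sup>2 = ovoid a b * \<theta> (ovoid a b)"
  unfolding aut_ovoid unfolding ovoid_def
  by (simp add: power2_eq_square algebra_simps char2)

text \<open>Coordinates of the Suzuki-Tits ovoid: \<open>None\<close> is the point spanned by the last basis vector
  and \<open>Some (a, b)\<close> the image of the first one under \<open>sz_S t a b\<close>.\<close>

fun rep :: "('a \<times> 'a) option \<Rightarrow> 'a ^ 4" where
  "rep None = vector [0, 0, 0, 1]"
| "rep (Some (a, b)) = vector [1, a, b, ovoid a b]"

text \<open>A further point on the tangent line that the Tits polarity attaches to a point. Preserving
  these lines forces the stabiliser of two points to be diagonal.\<close>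

fun tangent :: "('a \<times> 'a) option \<Rightarrow> 'a ^ 4" where
  "tangent None = vector [0, 0, 1, 0]"
| "tangent (Some (a, b)) = vector [0, 1, \<theta> a, a * \<theta> a + b]"

section \<open>Matrices acting on points and tangent lines\<close>

text \<open>The action is projective: vectors count up to scalars, and a tangent vector only modulo
  its point, hence \<open>u\<close>. A relation is used because an arbitrary matrix need not send
  ovoid points to ovoid points.\<close>

definition maps :: "'a ^ 4 ^ 4 \<Rightarrow> ('a \<times> 'a) option \<Rightarrow> ('a \<times> 'a) option \<Rightarrow> bool" where
  "maps g p q \<longleftrightarrow> (\<exists>s u v. s \<noteq> 0 \<and> v \<noteq> 0 \<and> g *v rep p = s *s rep q \<and> g *v tangent p = u *s rep q + v *s tangent q)"

lemma matrix_vector_mult_4: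
  "((A :: 'a ^ 4 ^ 4) *v x) $ i = A $ i $ 1 * x $ 1 + A $ i $ 2 * x $ 2 + A $ i $ 3 * x $ 3 + A $ i $ 4 * x $ 4"
  by (simp add: matrix_vector_mult_def sum_4)

lemmas vec_simps = vec_eq_iff forall_4 vector_4 matrix_vector_mult_4 matrix_mult_4

lemma rep_inj: "s *s rep p = s' *s rep q \<Longrightarrow> s \<noteq> 0 \<Longrightarrow> p = q"
  by (cases p rule: rep.cases; cases q rule: rep.cases) (auto simp: vec_simps)

lemma maps_unique: "maps g p q \<Longrightarrow> maps g p q' \<Longrightarrow> q = q'"
  unfolding maps_def using rep_inj by metis

lemma maps_one: "maps (mat 1) p p"
  unfolding maps_def by (intro exI[of _ 1] exI[of _ 0]) simp

lemma maps_mult: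
  assumes "maps g p q" "maps h q r"
  shows "maps (h ** g) p r"
proof -
  obtain s u v where 1: "s \<noteq> 0" "v \<noteq> 0" "g *v rep p = s *s rep q" "g *v tangent p = u *s rep q + v *s tangent q"
    using assms by (auto simp: maps_def)
  obtain s' u' v' where 2: "s' \<noteq> 0" "v' \<noteq> 0" "h *v rep q = s' *s rep r" "h *v tangent q = u' *s rep r + v' *s tangent r"
    using assms by (auto simp: maps_def)
  have "(h ** g) *v rep p = (s * s') *s rep r"
    using 1 2 by (simp add: vector_scalar_commute flip: matrix_vector_mul_assoc)
  moreover have "(h ** g) *v tangent p = (u * s' + v * u') *s rep r + (v * v') *s tangent r"
    using 1 2 by (simp add: vector_scalar_commute matrix_vector_right_distrib vector_sadd_rdistrib
        vector_add_ldistrib add.assoc flip: matrix_vector_mul_assoc)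
  ultimately show ?thesis
    using 1 2 unfolding maps_def by (metis mult_eq_0_iff)
qed

lemma maps_inj:
  assumes "maps g p q" "maps g p' q" "h ** g = mat 1"
  shows "p = p'"
proof -
  obtain s s' where s: "s \<noteq> 0" "s' \<noteq> 0" "g *v rep p = s *s rep q" "g *v rep p' = s' *s rep q"
    using assms by (auto simp: maps_def)
  have h: "x = h *v (g *v x)" for x
    using assms(3) by (simp add: matrix_vector_mul_assoc)
  have "s' *s rep p = h *v (s' *s (s *s rep q))"
    by (subst h) (simp add: s vector_scalar_commute)
  also have "\<dots> = s *s rep p'"
    by (subst h[of "rep p'"]) (simp add: s vector_scalar_commute mult.commute)
  finally show ?thesis
    using rep_inj s by metis
qed

lemma maps_inverse:
  assumes "maps g p q" "h ** g = mat 1"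
  shows "maps h q p"
proof -
  obtain s u v where 1: "s \<noteq> 0" "v \<noteq> 0" "g *v rep p = s *s rep q" "g *v tangent p = u *s rep q + v *s tangent q"
    using assms by (auto simp: maps_def)
  have h: "h *v (g *v x) = x" for x
    using assms(2) by (simp add: matrix_vector_mul_assoc)
  have "s *s (h *v rep q) = rep p"
    using h[of "rep p"] 1(3) by (simp add: vector_scalar_commute)
  then have r: "h *v rep q = (1 / s) *s rep p"
    using 1(1) by (metis divide_self_if times_divide_eq_left mult_1 vector_smult_assoc vector_smult_lid)
  have "u *s (h *v rep q) + v *s (h *v tangent q) = tangent p"
    using h[of "tangent p"] 1 by (simp add: vector_scalar_commute matrix_vector_right_distrib)
  then have "h *v tangent q = (- u / (s * v)) *s rep p + (1 / v) *s tangent p"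
    using 1(1,2) unfolding r by (auto simp: vec_eq_iff field_simps)
  then show ?thesis
    using 1 r unfolding maps_def by (metis divide_eq_0_iff zero_neq_one)
qed

lemma sz_S_mult: "sz_S t a b ** sz_S t c d = sz_S t (a + c) (b + \<theta> a * c + d)"
  by (simp add: vec_simps sz_S_def aut_add aut_mult aut_aut power2_eq_square algebra_simps char2)

text \<open>Affine points and their tangents are translates of those at the origin, so the
  \<open>sz_S\<close> act on them by their own group law \<open>sz_S_mult\<close>.\<close>

lemma rep_sz_S: "rep (Some (a, b)) = sz_S t a b *v rep (Some (0, 0))"
  "tangent (Some (a, b)) = sz_S t a b *v tangent (Some (0, 0))"
  by (simp_all add: vec_simps sz_S_def ovoid_def aut_simps)

lemma maps_sz_S: "maps (sz_S t a b) None None"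
  "maps (sz_S t a b) (Some (c, d)) (Some (a + c, b + \<theta> a * c + d))"
proof -
  show "maps (sz_S t a b) None None"
    unfolding maps_def
    by (rule exI[of _ 1], rule exI[of _ a], rule exI[of _ 1]) (simp add: vec_simps sz_S_def)
  show "maps (sz_S t a b) (Some (c, d)) (Some (a + c, b + \<theta> a * c + d))"
    unfolding maps_def rep_sz_S[of c d] rep_sz_S[of "a + c"] matrix_vector_mul_assoc sz_S_mult
    by (intro exI[of _ 1] exI[of _ 0]) simp
qed

lemma maps_sz_M:
  assumes "c \<noteq> 0"
  shows "maps (sz_M t c) None None"
    and "maps (sz_M t c) (Some (a, b)) (Some (a / c, b / (c * \<theta> c)))"
proof -
  \<comment> \<open>In terms of \<open>m\<close>, the preimage of \<open>c\<close> under
    \<open>\<theta>\<close>, all matrix entries are monomials in \<open>c\<close> and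
    \<open>m\<close>.\<close>
  define m where "m = c ^ 2 ^ t"
  have m: "m \<noteq> 0" "c ^ (1 + 2 ^ t) = c * m" "\<theta> c = m\<^sup>2" "\<theta> m = c"
    using assms aut_half aut_eq_half by (auto simp: m_def)
  show "maps (sz_M t c) None None"
    unfolding maps_def using assms m
    by (intro exI[of _ "inverse (c * m)"] exI[of _ 0] exI[of _ "inverse m"])
      (simp add: vec_simps sz_M_def flip: m_def)
  show "maps (sz_M t c) (Some (a, b)) (Some (a / c, b / (c * \<theta> c)))"
    unfolding maps_def using assms m
    by (intro exI[of _ "c * m"] exI[of _ 0] exI[of _ m])
      (simp add: vec_simps sz_M_def ovoid_def aut_divide aut_mult aut_power field_simps
         power2_eq_square flip: m_def)
qed

lemma maps_sz_T: "maps sz_T None (Some (0, 0))" "maps sz_T (Some (0, 0)) None"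
  "a \<noteq> 0 \<or> b \<noteq> 0 \<Longrightarrow> maps sz_T (Some (a, b)) (Some (b / ovoid a b, a / ovoid a b))"
proof -
  show "maps sz_T None (Some (0, 0))" "maps sz_T (Some (0, 0)) None"
    unfolding maps_def
    by (rule exI[of _ 1], rule exI[of _ 0], rule exI[of _ 1],
        simp add: vec_simps sz_T_def ovoid_def aut_simps)+
  assume ab: "a \<noteq> 0 \<or> b \<noteq> 0"
  define F where "F = ovoid a b"
  define P where "P = \<theta> F"
  \<comment> \<open>\<open>sz_T\<close> reverses coordinates, so the image of the tangent vector
    starts with its last coordinate \<open>u\<close>. Affine \<open>rep\<close> vectors start with
    \<open>1\<close> and \<open>tangent\<close> vectors with \<open>0\<close>, so \<open>u\<close>
    must be the coefficient of \<open>rep\<close>.\<close>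
  define u where "u = a * \<theta> a + b"
  have F0: "F \<noteq> 0" "P \<noteq> 0"
    using ab ovoid_eq_0_iff by (auto simp: F_def P_def aut_simps)
  have P: "P = a\<^sup>2 * (\<theta> a)\<^sup>2 + \<theta> a * \<theta> b + b\<^sup>2"
    unfolding P_def F_def by (rule aut_ovoid)
  have F: "F = a\<^sup>2 * \<theta> a + a * b + \<theta> b"
    by (simp add: F_def ovoid_def)
  have 1: "b\<^sup>2 * \<theta> b + a * b * P + \<theta> a * F\<^sup>2 = F * P"
    using ovoid_aut_relation[of b a] by (simp add: F_def P_def)
  have 2: "u * b + P = \<theta> a * F" "u * a + \<theta> b = F" "u * F + b * \<theta> b + a * P = 0"
    by (simp_all add: u_def F P power2_eq_square algebra_simps char2)
  have o: "ovoid (b / F) (a / F) = 1 / F"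
  proof -
    have "ovoid (b / F) (a / F) = (b\<^sup>2 * \<theta> b + a * b * P + \<theta> a * F\<^sup>2) / (F\<^sup>2 * P)"
      using F0 by (simp add: ovoid_def aut_divide field_simps power2_eq_square flip: P_def)
    also have "\<dots> = 1 / F"
      using F0 unfolding 1 by (simp add: power2_eq_square)
    finally show ?thesis .
  qed
  \<comment> \<open>\<open>t2\<close>, \<open>t3\<close> and \<open>t4\<close> are coordinates two
    to four of the tangent equation; the second one forces the coefficient
    \<open>P / F\<close>.\<close>
  have t2: "\<theta> a = u * (b / F) + P / F"
    using F0 2(1) by (simp add: field_simps)
  have t3: "1 = u * (a / F) + P / F * (\<theta> b / P)"
    using F0 2(2) by (simp add: field_simps)
  have "u * (1 / F) + P / F * (b / F * (\<theta> b / P) + a / F) = (u * F + b * \<theta> b + a * P) / F\<^sup>2"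
    using F0 by (simp add: field_simps power2_eq_square)
  then have t4: "0 = u * (1 / F) + P / F * (b / F * (\<theta> b / P) + a / F)"
    by (simp add: 2(3))
  have "sz_T *v rep (Some (a, b)) = F *s rep (Some (b / F, a / F))"
    using F0 by (simp add: vec_simps sz_T_def o flip: F_def)
  moreover have "sz_T *v tangent (Some (a, b)) = u *s rep (Some (b / F, a / F)) + (P / F) *s tangent (Some (b / F, a / F))"
    using F0 t2[symmetric] t3[symmetric] t4[symmetric] by (simp add: vec_simps sz_T_def o aut_divide flip: F_def P_def u_def)
  ultimately show "maps sz_T (Some (a, b)) (Some (b / ovoid a b, a / ovoid a b))"
    using F0 unfolding maps_def by (fold F_def) (intro exI[of _ F] exI[of _ u] exI[of _ "P / F"], simp)
qed

section \<open>The invariant form and the stabiliser of the ovoid\<close>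

text \<open>Being symmetric with zero diagonal, \<open>sz_T\<close> is in characteristic two the
  Gram matrix of a symplectic form. Its invariance removes the scalar freedom that
  \<open>maps\<close> leaves.\<close>

definition stab_form :: "'a ^ 4 ^ 4 \<Rightarrow> bool" where
  "stab_form g \<longleftrightarrow> transpose g ** sz_T ** g = sz_T"

lemma stab_form_generators: "stab_form (sz_S t a b)" "c \<noteq> 0 \<Longrightarrow> stab_form (sz_M t c)" "stab_form sz_T"
  unfolding stab_form_def
  by (simp_all add: vec_simps sz_S_def sz_M_def sz_T_def transpose_def power2_eq_square algebra_simps char2)

lemma stab_form_one: "stab_form (mat 1)"
  by (simp add: stab_form_def)

lemma stab_form_mult:
  assumes "stab_form g" "stab_form h"
  shows "stab_form (g ** h)"
proof -
  have "transpose (g ** h) ** sz_T ** (g ** h) = transpose h ** (transpose g ** sz_T ** g) ** h"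
    by (simp only: matrix_transpose_mul matrix_mul_assoc)
  then show ?thesis
    using assms by (simp add: stab_form_def)
qed

lemma stab_form_inverse:
  assumes "stab_form g" "g ** h = mat 1"
  shows "stab_form h"
proof -
  have "transpose h ** sz_T ** h = transpose h ** (transpose g ** sz_T ** g) ** h"
    using assms by (simp add: stab_form_def)
  also have "\<dots> = transpose (g ** h) ** sz_T ** (g ** h)"
    by (simp only: matrix_transpose_mul matrix_mul_assoc)
  finally show ?thesis
    using assms(2) by (simp add: stab_form_def)
qed

text \<open>\<open>Sz t\<close> is known only by generators; this group collects the properties that
  all its elements inherit from them.\<close>

definition ovoid_stab :: "('a ^ 4 ^ 4) set" where
  "ovoid_stab = {g. invertible g \<and> stab_form g \<and> (\<forall>p. \<exists>q. maps g p q)}"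

lemma subgroup_ovoid_stab: "subgroup ovoid_stab GL4"
proof -
  interpret GL: group "GL4 :: ('a ^ 4 ^ 4) monoid" by (rule group_GL4)
  show ?thesis
  proof (rule GL.subgroupI)
    show "ovoid_stab \<subseteq> carrier GL4"
      by (auto simp: ovoid_stab_def GL4_def)
    show "ovoid_stab \<noteq> {}"
      using maps_one stab_form_one invertible_def by (fastforce simp: ovoid_stab_def)
    show "g \<otimes>\<^bsub>GL4\<^esub> h \<in> ovoid_stab" if "g \<in> ovoid_stab" "h \<in> ovoid_stab" for g h
    proof -
      have "\<exists>q. maps (g ** h) p q" for p
        using that maps_mult unfolding ovoid_stab_def by blast
      then show ?thesis
        using that by (simp add: ovoid_stab_def GL4_def invertible_mult stab_form_mult)
    qed
    show "inv\<^bsub>GL4\<^esub> g \<in> ovoid_stab" if g: "g \<in> ovoid_stab" for g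
    proof -
      define h where "h = inv\<^bsub>GL4\<^esub> g"
      have gh: "g ** h = mat 1" "h ** g = mat 1"
        using g GL.r_inv[of g] GL.l_inv[of g] by (auto simp: h_def GL4_def ovoid_stab_def)
      have "\<forall>p. \<exists>q. maps g p q"
        using g by (simp add: ovoid_stab_def)
      then obtain f where f: "\<And>p. maps g p (f p)"
        by metis
      \<comment> \<open>\<open>maps_inverse\<close> reaches only points in the image of
        \<open>f\<close>; on the finite point set, injectivity makes these all points.\<close>
      have "inj f"
        using f maps_inj[OF _ _ gh(2)] by (metis injI)
      then have "surj f"
        by (simp add: finite_UNIV_inj_surj)
      then have "\<exists>q. maps h p q" for p
        using f maps_inverse[OF _ gh(2)] by (metis surjD)
      moreover have "stab_form h"
        using g gh stab_form_inverse by (auto simp: ovoid_stab_def)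
      moreover have "invertible h"
        using gh by (auto simp: invertible_def)
      ultimately show ?thesis
        by (simp add: ovoid_stab_def h_def)
    qed
  qed
qed

section \<open>The action of \<open>Sz(q)\<close> on the ovoid\<close>

lemma generators_in_Sz:
  "sz_S t a b \<in> carrier (Sz t)" "c \<noteq> 0 \<Longrightarrow> sz_M t c \<in> carrier (Sz t)" "(sz_T :: 'a ^ 4 ^ 4) \<in> carrier (Sz t)"
  for a b c :: 'a
  by (auto simp: Sz_def intro!: generate.incl)

lemma Sz_subset: "carrier (Sz t) \<subseteq> ovoid_stab"
proof -
  interpret GL: group "GL4 :: ('a ^ 4 ^ 4) monoid" by (rule group_GL4)
  have "\<exists>q. maps (sz_S t a b) p q" for a b p
    using maps_sz_S by (cases p rule: rep.cases) blast+
  moreover have "\<exists>q. maps (sz_M t c) p q" if "c \<noteq> 0" for c p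
    using maps_sz_M[OF that] by (cases p rule: rep.cases) blast+
  moreover have "\<exists>q. maps sz_T p q" for p
  proof (cases p rule: rep.cases)
    case (2 a b)
    then show ?thesis
      using maps_sz_T(2) maps_sz_T(3)[of a b] by (cases "a = 0 \<and> b = 0") auto
  qed (use maps_sz_T(1) in auto)
  ultimately show ?thesis
    unfolding Sz_def using subgroup_ovoid_stab
    by (simp, intro GL.generate_subgroup_incl)
      (auto simp: ovoid_stab_def invertible_sz_S invertible_sz_M invertible_sz_T stab_form_generators)
qed

lemma Sz_simps: "monoid.mult (Sz t) = (**)" "one (Sz t) = mat 1"
  by (simp_all add: Sz_def GL4_def)

definition act :: "'a ^ 4 ^ 4 \<Rightarrow> ('a \<times> 'a) option \<Rightarrow> ('a \<times> 'a) option" where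
  "act g p = (THE q. maps g p q)"

lemma act_eqI: "maps g p q \<Longrightarrow> act g p = q"
  unfolding act_def using maps_unique by blast

lemma maps_act: "g \<in> carrier (Sz t) \<Longrightarrow> maps g p (act g p)"
  using Sz_subset act_eqI unfolding ovoid_stab_def by blast

lemma group_action_Sz: "group_action (Sz t) UNIV act"
proof -
  have mult: "act (g ** h) = act g \<circ> act h" if "g \<in> carrier (Sz t)" "h \<in> carrier (Sz t)" for g h
  proof
    show "act (g ** h) p = (act g \<circ> act h) p" for p
      using maps_mult[OF maps_act[OF that(2)] maps_act[OF that(1)]] act_eqI by simp
  qed
  interpret G: group "Sz t :: ('a ^ 4 ^ 4) monoid" by (rule group_Sz)
  have bij: "bij (act g)" if g: "g \<in> carrier (Sz t)" for g
  proof (rule o_bij)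
    have one: "act (mat 1) = id"
      using act_eqI[OF maps_one] by auto
    let ?h = "inv\<^bsub>Sz t\<^esub> g"
    show "act ?h \<circ> act g = id" "act g \<circ> act ?h = id"
      using mult[of ?h g] mult[of g ?h] G.l_inv[OF g] G.r_inv[OF g] g one by (simp_all add: Sz_simps)
  qed
  have "act \<in> hom (Sz t) (BijGroup UNIV)"
  proof (rule homI)
    show "act g \<in> carrier (BijGroup UNIV)" if "g \<in> carrier (Sz t)" for g
      using bij[OF that] by (simp add: BijGroup_def Bij_def)
    show "act (g \<otimes>\<^bsub>Sz t\<^esub> h) = act g \<otimes>\<^bsub>BijGroup UNIV\<^esub> act h"
      if "g \<in> carrier (Sz t)" "h \<in> carrier (Sz t)" for g h
      using bij mult that by (auto simp: BijGroup_def Bij_def Sz_simps compose_def)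
  qed
  then show ?thesis
    by (simp add: group_action_def group_hom_def group_hom_axioms_def group_Sz group_BijGroup)
qed

section \<open>Elements fixing or interchanging the base points\<close>

text \<open>Fixing two points and their tangent lines leaves only two possible off-diagonal entries.
  The form removes these and pairs the diagonal entries; the image of a third point then expresses
  them all through one \<open>c\<close>.\<close>

lemma stabiliser_diagonal:
  assumes g: "g \<in> carrier (Sz t)" "act g None = None" "act g (Some (0, 0)) = Some (0, 0)"
  shows "\<exists>c. c \<noteq> 0 \<and> g = sz_M t c"
proof -
  have n: "maps g None None" and z: "maps g (Some (0, 0)) (Some (0, 0))"
    using maps_act[OF g(1)] g by metis+
  \<comment> \<open>The third point is \<open>Some (1, 0)\<close>. Its image is not
    \<open>None\<close>, since \<open>g\<close> is injective on points and fixes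
    \<open>None\<close>.\<close>
  obtain a b where m: "maps g (Some (1, 0)) (Some (a, b))"
  proof -
    have "act g (Some (1, 0)) \<noteq> None"
    proof
      assume "act g (Some (1, 0)) = None"
      then have "maps g (Some (1, 0)) None"
        using maps_act[OF g(1)] by metis
      moreover obtain h where "h ** g = mat 1"
        using g(1) Sz_subset by (auto simp: ovoid_stab_def invertible_def)
      ultimately show False
        using maps_inj n by blast
    qed
    then show ?thesis
      using that maps_act[OF g(1)] by (metis not_None_eq surj_pair)
  qed
  have o: "ovoid 0 0 = 0" "ovoid 1 0 = 1"
    by (simp_all add: ovoid_def aut_simps)
  have col4: "g $ 1 $ 4 = 0" "g $ 2 $ 4 = 0" "g $ 3 $ 4 = 0" "g $ 4 $ 4 \<noteq> 0"
    and col3: "g $ 1 $ 3 = 0" "g $ 2 $ 3 = 0"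
    using n by (auto simp: maps_def vec_simps)
  have col1: "g $ 1 $ 1 \<noteq> 0" "g $ 2 $ 1 = 0" "g $ 3 $ 1 = 0" "g $ 4 $ 1 = 0"
    and col2: "g $ 3 $ 2 = 0" "g $ 4 $ 2 = 0"
    using z by (auto simp: maps_def vec_simps o aut_simps)
  have "stab_form g"
    using g(1) Sz_subset by (auto simp: ovoid_stab_def)
  \<comment> \<open>Entries \<open>(1, 3)\<close> and \<open>(2, 4)\<close> of the form equation
    kill the remaining off-diagonal entries; \<open>(1, 4)\<close> and \<open>(2, 3)\<close> make
    opposite diagonal entries inverse to each other.\<close>
  then have f: "g $ 1 $ 1 * g $ 4 $ 4 = 1" "g $ 2 $ 2 * g $ 3 $ 3 = 1" "g $ 4 $ 3 = 0" "g $ 1 $ 2 = 0"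
    using col1 col2 col3 col4
    by (auto simp: stab_form_def vec_simps transpose_def sz_T_def)
  \<comment> \<open>The first two diagonal entries of \<open>sz_M t c\<close> have quotient
    \<open>c\<close>.\<close>
  define c where "c = g $ 1 $ 1 / g $ 2 $ 2"
  define k where "k = c ^ 2 ^ t"
  have nz: "g $ 2 $ 2 \<noteq> 0" "c \<noteq> 0"
    using f col1 by (auto simp: c_def)
  have k: "k \<noteq> 0" "c ^ (1 + 2 ^ t) = c * k" "\<theta> c = k\<^sup>2"
    using nz aut_eq_half by (auto simp: k_def)
  have e: "g $ 2 $ 2 = g $ 1 $ 1 * a" "g $ 4 $ 4 = g $ 1 $ 1 * ovoid a b" "b = 0"
    using m col1 col2 col3 col4 f by (auto simp: maps_def vec_simps o aut_simps)
  have a: "a = 1 / c"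
    using e nz col1 by (auto simp: c_def field_simps)
  have "(g $ 1 $ 1)\<^sup>2 * (1 / c)\<^sup>2 * (1 / k)\<^sup>2 = 1"
    using f(1) e a by (simp add: ovoid_def aut_divide aut_simps k(3) power2_eq_square)
  then have "(g $ 1 $ 1)\<^sup>2 = (c * k)\<^sup>2"
    using nz k by (simp add: field_simps)
  then have 1: "g $ 1 $ 1 = c * k"
    by (simp only: power2_eq_iff2)
  have 2: "g $ 2 $ 2 = k"
    using 1 e(1) a nz by simp
  have 3: "g $ 3 $ 3 = inverse k" "g $ 4 $ 4 = inverse (c * k)"
    using f(1,2) 1 2 inverse_unique by metis+
  have "g = sz_M t c"
    using f(3,4) col1(2-) col2 col3 col4(1-3) 1 2 3 k(2) by (simp add: vec_simps sz_M_def flip: k_def)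
  then show ?thesis
    using nz by blast
qed

lemma sz_M_one: "sz_M t 1 = mat (1::'a)"
  by (simp add: vec_simps sz_M_def mat_def)

lemma sz_T_mult_sz_T: "sz_T ** sz_T = (mat 1 :: 'a ^ 4 ^ 4)"
  by (simp add: vec_simps sz_T_def mat_def)

text \<open>Applying \<open>\<theta>\<close> to the hypothesis gives
  \<open>\<theta> c * c\<^sup>2 = 1\<close>; dividing by the hypothesis leaves
  \<open>c = 1\<close>.\<close>

lemma unit_of_aut: "c = 1" if "c * \<theta> c = 1" for c :: 'a
proof -
  have "\<theta> c * c\<^sup>2 = 1"
    using arg_cong[OF that, of \<theta>] by (simp add: aut_mult aut_aut aut_simps)
  then have "(c * \<theta> c) * c = 1"
    by (simp add: power2_eq_square ac_simps)
  then show ?thesis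
    using that by simp
qed

text \<open>Every element of \<open>Sz t\<close> that interchanges the two base points has this
  form.\<close>

lemma swap_fixes_point:
  assumes "c \<noteq> 0"
  shows "\<exists>r. maps (sz_T ** sz_M t c) r r"
proof -
  define m where "m = c ^ 2 ^ t"
  have m: "m \<noteq> 0" "\<theta> c = m\<^sup>2" "\<theta> m = c"
    using assms aut_half aut_eq_half by (auto simp: m_def)
  \<comment> \<open>The fixed point is \<open>Some (s, s * m)\<close>, where
    \<open>\<theta> s = m\<close>: \<open>sz_M t c\<close> sends it to
    \<open>Some (1 / s, 1 / (s * m))\<close>, and \<open>sz_T\<close> brings it back.\<close>
  obtain s where s: "s\<^sup>2 = c"
    using ex_sqrt by blast
  have s0: "s \<noteq> 0"
    using s assms by auto
  have "(\<theta> s)\<^sup>2 = m\<^sup>2"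
    using m s by (metis aut_power)
  then have ts: "\<theta> s = m"
    by (simp only: power2_eq_iff2)
  have p: "s / c = 1 / s" "s * m / (c * \<theta> c) = 1 / (s * m)"
    using s0 m by (simp_all add: power2_eq_square flip: s)
  have "ovoid (1 / s) (1 / (s * m)) = 1 / (c * m)"
    using s0 m(1) assms
    by (simp add: ovoid_def aut_divide aut_mult ts m(3) aut_simps s power_divide char2)
       (simp add: field_simps power2_eq_square char2 flip: s)
  moreover have "1 / (s * m) / (1 / (c * m)) = s" "1 / s / (1 / (c * m)) = s * m"
    using s0 m(1) by (simp_all add: power2_eq_square flip: s)
  ultimately have "maps sz_T (Some (s / c, s * m / (c * \<theta> c))) (Some (s, s * m))"
    using maps_sz_T(3)[of "1 / s" "1 / (s * m)"] s0 unfolding p by simp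
  from maps_mult[OF maps_sz_M(2)[OF assms] this] show ?thesis
    by blast
qed

section \<open>Double transitivity and the locale conditions\<close>

text \<open>The \<open>sz_S\<close> fix \<open>None\<close> and move the origin to every affine
  point, while \<open>sz_T\<close> moves \<open>None\<close> to the origin; products of these reach
  every pair.\<close>

lemma ex_act_pair:
  assumes "p \<noteq> q"
  shows "\<exists>h \<in> carrier (Sz t). act h None = p \<and> act h (Some (0, 0)) = q"
proof -
  interpret G: group_action "Sz t :: ('a ^ 4 ^ 4) monoid" UNIV act by (rule group_action_Sz)
  interpret group "Sz t :: ('a ^ 4 ^ 4) monoid" by (rule group_Sz)
  have S: "act (sz_S t a b) None = None" "act (sz_S t a b) (Some (0, 0)) = Some (a, b)" for a b
    using act_eqI[OF maps_sz_S(1)] act_eqI[OF maps_sz_S(2), of a b 0 0] by simp_all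
  have T: "act sz_T None = Some (0, 0)"
    using act_eqI[OF maps_sz_T(1)] .
  note comp = G.composition_rule[OF UNIV_I]
  show ?thesis
  proof (cases p rule: rep.cases)
    case 1
    then obtain a b where "q = Some (a, b)"
      using assms by (cases q rule: rep.cases) auto
    then show ?thesis
      using 1 S generators_in_Sz(1) by metis
  next
    case (2 a b)
    let ?k = "sz_S t a b \<otimes>\<^bsub>Sz t\<^esub> sz_T"
    have k: "?k \<in> carrier (Sz t)" "act ?k None = p"
      using generators_in_Sz 2 S T comp by auto
    \<comment> \<open>As \<open>?k\<close> sends \<open>None\<close> to \<open>p \<noteq> q\<close>,
      the preimage \<open>r\<close> of \<open>q\<close> is affine. Multiplying \<open>?k\<close> on
      the right by the \<open>sz_S\<close> that moves the origin to \<open>r\<close> keeps the image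
      of \<open>None\<close>.\<close>
    obtain r where r: "act ?k r = q"
      using G.bij_prop1[OF k(1), of q] by blast
    then obtain c d where cd: "r = Some (c, d)"
      using assms k by (cases r rule: rep.cases) auto
    have "act (?k \<otimes>\<^bsub>Sz t\<^esub> sz_S t c d) None = p" "act (?k \<otimes>\<^bsub>Sz t\<^esub> sz_S t c d) (Some (0, 0)) = q"
      using comp[OF k(1) generators_in_Sz(1)] S k r cd by simp_all
    then show ?thesis
      using m_closed[OF k(1) generators_in_Sz(1)] by (intro bexI conjI)
  qed
qed

lemma double_action_Sz: "double_action (Sz t) UNIV act None (Some (0, 0)) (sz_S t 0 1)"
proof -
  interpret group_action "Sz t :: ('a ^ 4 ^ 4) monoid" UNIV act by (rule group_action_Sz)
  interpret group "Sz t :: ('a ^ 4 ^ 4) monoid" by (rule group_Sz)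
  have fixed: "a / c = a \<and> b / (c * \<theta> c) = b" if "c \<noteq> 0" "act (sz_M t c) (Some (a, b)) = Some (a, b)" for a b c
    using act_eqI[OF maps_sz_M(2)[OF that(1)], of a b] that(2) by simp
  show ?thesis
  proof (intro double_action.intro group_action_Sz double_action_axioms.intro)
    fix p q :: "('a \<times> 'a) option" assume "p \<noteq> q"
    then obtain h where h: "h \<in> carrier (Sz t)" "act h None = p" "act h (Some (0, 0)) = q"
      using ex_act_pair by blast
    then have "act (inv\<^bsub>Sz t\<^esub> h) p = None" "act (inv\<^bsub>Sz t\<^esub> h) q = Some (0, 0)"
      using orbit_sym_aux[OF h(1) UNIV_I] by auto
    then show "\<exists>h \<in> carrier (Sz t). act h p = None \<and> act h q = Some (0, 0)"
      using inv_closed[OF h(1)] by blast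
  next
    fix g r
    assume fixes_three: "g \<in> carrier (Sz t)" "act g None = None" "act g (Some (0, 0)) = Some (0, 0)"
      "r \<noteq> None" "r \<noteq> Some (0, 0)" "act g r = r"
    then obtain c where c: "c \<noteq> 0" "g = sz_M t c"
      using stabiliser_diagonal[OF fixes_three(1-3)] by blast
    obtain a b where r: "r = Some (a, b)"
      using fixes_three(4) by (cases r rule: rep.cases) auto
    have ab: "a \<noteq> 0 \<or> b \<noteq> 0"
      using fixes_three(5) r by auto
    have "a / c = a" "b / (c * \<theta> c) = b"
      using fixed[OF c(1)] fixes_three(6) r c by auto
    \<comment> \<open>If \<open>a \<noteq> 0\<close>, the first equation suffices; otherwise
      \<open>b \<noteq> 0\<close> gives \<open>c * \<theta> c = 1\<close>.\<close>
    then have "c = 1"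
      using ab c(1) unit_of_aut[of c] aut_simps(3)[of c] by (auto simp: field_simps)
    then show "g = \<one>\<^bsub>Sz t\<^esub>"
      using c by (simp add: sz_M_one Sz_simps)
  next
    fix g
    assume square: "g \<in> carrier (Sz t)" "act g None = None" "act g (Some (0, 0)) = Some (0, 0)"
      "g \<otimes>\<^bsub>Sz t\<^esub> g = \<one>\<^bsub>Sz t\<^esub>"
    then obtain c where c: "c \<noteq> 0" "g = sz_M t c"
      using stabiliser_diagonal[OF square(1-3)] by blast
    define k where "k = c ^ 2 ^ t"
    have "sz_M t c ** sz_M t c = (mat 1 :: 'a ^ 4 ^ 4)"
      using square(4) c by (simp add: Sz_simps)
    then have "(sz_M t c ** sz_M t c) $ 1 $ 1 = (1 :: 'a)" "(sz_M t c ** sz_M t c) $ 2 $ 2 = (1 :: 'a)"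
      by (simp_all add: mat_def)
    then have "(c * k)\<^sup>2 = 1" "k\<^sup>2 = 1"
      by (simp_all add: vec_simps sz_M_def power2_eq_square flip: k_def)
    then have "c = 1"
      by (simp add: power2_eq_1_iff2)
    then show "g = \<one>\<^bsub>Sz t\<^esub>"
      using c by (simp add: sz_M_one Sz_simps)
  next
    fix g
    assume swaps: "g \<in> carrier (Sz t)" "act g None = Some (0, 0)" "act g (Some (0, 0)) = None"
    \<comment> \<open>\<open>sz_T\<close> undoes the interchange, so \<open>?h\<close> fixes both
      base points and is diagonal.\<close>
    let ?h = "sz_T \<otimes>\<^bsub>Sz t\<^esub> g"
    have T: "act sz_T None = Some (0, 0)" "act sz_T (Some (0, 0)) = None"
      using act_eqI maps_sz_T(1,2) by blast+
    have h: "?h \<in> carrier (Sz t)" "act ?h None = None" "act ?h (Some (0, 0)) = Some (0, 0)"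
      using swaps T generators_in_Sz(3) composition_rule[OF UNIV_I generators_in_Sz(3) swaps(1)] by auto
    obtain c where c: "c \<noteq> 0" "?h = sz_M t c"
      using stabiliser_diagonal[OF h] by blast
    then have "g = sz_T ** sz_M t c"
      by (metis Sz_simps(1) matrix_mul_assoc matrix_mul_lid sz_T_mult_sz_T)
    then show "\<exists>r \<in> UNIV. act g r = r"
      using swap_fixes_point[OF c(1)] act_eqI by blast
  next
    \<comment> \<open>\<open>sz_S t 0 1\<close> adds \<open>1\<close> to the second affine
      coordinate.\<close>
    show "act (sz_S t 0 1) p = p \<longleftrightarrow> p = None" for p
      using act_eqI[OF maps_sz_S(1), of 0 1] act_eqI[OF maps_sz_S(2), of 0 1]
      by (cases p rule: rep.cases) (auto simp: aut_simps)
  qed (auto intro: generators_in_Sz finite_subset[OF subset_UNIV])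
qed

end

theorem theorem5p10:
  fixes t :: nat
  assumes "t \<ge> 1"
    and "CARD('a::{field,finite}) = 2 ^ (2 * t + 1)"
  shows "\<not> strongly_conn (with_proj (engel_graph (Sz t :: ('a ^ 4 ^ 4) monoid)))"
proof -
  interpret suzuki_field t "TYPE('a)"
    by unfold_locales (rule assms(2))
  show ?thesis
    by (rule double_action.engel_graph_not_strongly_conn[OF double_action_Sz])
qed

end
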